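(* Let $R>0$. The following relations hold: $$\mathbf P_{\mathrm{add}}\widehat{\underline{\boldsymbol\beta}}_R=\mathbf P_{\mathbf S,R}\widehat{\underline{\boldsymbol\beta}}_{ll}\qquad\text{and}\qquad(\mathbf I-\mathbf P_{\mathrm{add}})\widehat{\underline{\boldsymbol\beta}}_R=(\mathbf I-\mathbf A_R)(\mathbf I-\mathbf P_{\mathbf S,R})\widehat{\underline{\boldsymbol\beta}}_{ll}.$$
   Context: Data $(\underline{\mathbf X}_i,Y_i)\in[0,1]^d\times\mathbb R$, $i=1,\dots,n$; bandwidths $h_1,\dots,h_d>0$; nonnegative kernel weights $K_h(\underline{\mathbf X}_i,\underline{\mathbf x})\ge0$. **Grid and spaces.** The output grid is $\{t^1_1,\dots,t^1_{m_1}\}\times\dots\times\{t^d_1,\dots,t^d_{m_d}\}\subset[0,1]^d$, with its $m=m_1\cdots m_d$ points enumerated as $\underline{\mathbf t}_1,\dots,\underline{\mathbf t}_m$. $\mathbf F_{\mathrm{full}}=\mathbb R^{m(d+1)}$ consists of the stacked vectors $\underline{\boldsymbol\beta}=\mathrm{col}_j(\underline{\boldsymbol\beta}^{(j)})$ with $\underline{\boldsymbol\beta}^{(j)}=(\beta^{(j)}_0,\dots,\beta^{(j)}_d)\in\mathbb R^{d+1}$, with Euclidean norm $\|\cdot\|$. $\mathbf F_{\mathrm{add}}\subset\mathbf F_{\mathrm{full}}$ is the subspace of those $\underline{\boldsymbol\beta}$ for which there are functions $r^0,\dots,r^d:[0,1]^d\to\mathbb R$, $r^0$ additive (a sum of functions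 of single coordinates) and $r^k(\underline{\mathbf x})$ depending only on $x_k$ for $k\ge1$, with $\beta^{(j)}_\ell=r^\ell(\underline{\mathbf t}_j)$ for all $j,\ell$. $\mathbf P_{\mathrm{add}}$ is the orthogonal projection onto $\mathbf F_{\mathrm{add}}$, and $\mathbf Z$ is a real matrix with $\mathbf Z^\top\mathbf Z=\mathbf P_{\mathrm{add}}$. **Local linear estimator.** With $u_{i,0}(\underline{\mathbf x})=1$, $u_{i,k}(\underline{\mathbf x})=(X_{i,k}-x_k)/h_k$ for $k\ge1$, let $\mathbf S^{(j)}$ be the $(d+1)\times(d+1)$ matrix with entries $\frac1n\sum_iK_h(\underline{\mathbf X}_i,\underline{\mathbf t}_j)u_{i,\ell}(\underline{\mathbf t}_j)u_{i,l}(\underline{\mathbf t}_j)$, $\underline{\mathbf L}^{(j)}$ the vector with entries $\frac1n\sum_iK_h(\underline{\mathbf X}_i,\underline{\mathbf t}_j)u_{i,\ell}(\underline{\mathbf t}_j)Y_i$ ($\ell,l=0,\dots,d$), $\mathbf S=\mathrm{diag}_j(\mathbf S^{(j)})$ (block-diagonal) and $\underline{\mathbf L}=\mathrm{col}_j(\underline{\mathbf L}^{(j)})$. Let $$SSR(\underline\beta,\underline{\mathbf x})=\frac1n\sum_{i=1}^n\Big(Y_i-\beta_0-\sum_{k=1}^d\beta_k\tfrac{X_{i,k}-x_k}{h_k}\Big)^2K_h(\underline{\mathbf X}_i,\underline{\mathbf x}).$$ $\widehat{\underline{\boldsymbol\beta}}_{ll}=\mathrm{col}_j(\widehat{\underline{\boldsymbol\beta}}_{ll}^{(j)})$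 is the local linear estimator: $\widehat{\underline{\boldsymbol\beta}}_{ll}^{(j)}$ minimizes $SSR(\cdot,\underline{\mathbf t}_j)$, equivalently $\mathbf S^{(j)}\widehat{\underline{\boldsymbol\beta}}_{ll}^{(j)}=\underline{\mathbf L}^{(j)}$. **Oblique projection.** $\mathbf A_R=R(\mathbf S+R\mathbf I)^{-1}$ and $$\mathbf P_{\mathbf S,R}=\mathbf Z^\top\{(\mathbf I-\mathbf Z\mathbf Z^\top)+\mathbf Z(\mathbf I-\mathbf A_R)\mathbf Z^\top\}^{-}\mathbf Z(\mathbf I-\mathbf A_R),$$ where $\{\cdot\}^-$ denotes any generalized inverse; the matrix in braces equals $\mathbf I-\mathbf Z\mathbf A_R\mathbf Z^\top$. **Penalized estimator.** $$\widehat{\underline{\boldsymbol\beta}}_R=\arg\min_{\underline{\boldsymbol\beta}\in\mathbf F_{\mathrm{full}}}\sum_{j=1}^mSSR(\underline{\boldsymbol\beta}^{(j)},\underline{\mathbf t}_j)+R\|(\mathbf I-\mathbf P_{\mathrm{add}})\underline{\boldsymbol\beta}\|^2,$$ with normal equations $(\mathbf S+R(\mathbf I-\mathbf P_{\mathrm{add}}))\widehat{\underline{\boldsymbol\beta}}_R=\underline{\mathbf L}$, solved by $$\widehat{\underline{\boldsymbol\beta}}_R=(\mathbf I+\mathbf A_R\mathbf Z^\top\{\mathbf I-\mathbf Z\mathbf A_R\mathbf Z^\top\}^{-}\mathbf Z)(\mathbf S+R\mathbf I)^{-1}\underline{\mathbf L}.$$ The minimizer need not be unique; if it is not, $\widehat{\underline{\boldsymbol\beta}}_R$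 denotes the one given by this formula, with the same generalized inverse as in $\mathbf P_{\mathbf S,R}$. *)

theory Defs
  imports "HOL-Analysis.Analysis"
begin

text \<open>
  Index types: \<open>'n\<close> for the observations, \<open>'d\<close> for the coordinates \<open>1, \<dots>, d\<close>, \<open>'m\<close> for the
  enumeration of the output grid, \<open>'p\<close> for the rows of \<open>Z\<close>. The indices \<open>0, \<dots>, d\<close> of a local
  parameter are \<open>None\<close> (intercept) and \<open>Some k\<close> (slope in direction \<open>k\<close>). The component
  \<open>\<beta> $ (j, l)\<close> of a stacked vector is the \<open>l\<close>-th entry of its \<open>j\<close>-th block.
\<close>

type_synonym ('m, 'd) full = "real ^ ('m \<times> 'd option)"
type_synonym ('m, 'd) full_matrix = "real ^ ('m \<times> 'd option) ^ ('m \<times> 'd option)"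

definition block :: "('m::finite, 'd::finite) full \<Rightarrow> 'm \<Rightarrow> real ^ ('d option)"
  where "block b j = (\<chi> l. b $ (j, l))"


subsection \<open>The additive subspace and its orthogonal projection\<close>

definition additive_on_cube :: "(real ^ 'd::finite \<Rightarrow> real) \<Rightarrow> bool"
  where "additive_on_cube r \<longleftrightarrow>
    (\<exists>g :: 'd \<Rightarrow> real \<Rightarrow> real. \<forall>x\<in>cbox 0 1. r x = (\<Sum>k\<in>UNIV. g k (x $ k)))"

definition depends_only_on_cube :: "'d::finite \<Rightarrow> (real ^ 'd \<Rightarrow> real) \<Rightarrow> bool"
  where "depends_only_on_cube k r \<longleftrightarrow>
    (\<exists>g :: real \<Rightarrow> real. \<forall>x\<in>cbox 0 1. r x = g (x $ k))"

text \<open>The functions \<open>r l\<close> are only constrained on the unit cube, which contains all grid points.\<close>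

definition F_add :: "('m::finite \<Rightarrow> real ^ 'd::finite) \<Rightarrow> ('m, 'd) full set"
  where "F_add t = {b. \<exists>r :: 'd option \<Rightarrow> real ^ 'd \<Rightarrow> real.
    additive_on_cube (r None) \<and> (\<forall>k. depends_only_on_cube k (r (Some k))) \<and>
    (\<forall>j l. b $ (j, l) = r l (t j))}"

definition is_orthogonal_projection :: "real ^ 'a ^ 'a::finite \<Rightarrow> (real ^ 'a) set \<Rightarrow> bool"
  where "is_orthogonal_projection P W \<longleftrightarrow>
    (\<forall>v. P *v v \<in> W \<and> (\<forall>w\<in>W. orthogonal (v - P *v v) w))"

definition orthogonal_projection :: "(real ^ 'a) set \<Rightarrow> real ^ 'a ^ 'a::finite"
  where "orthogonal_projection W = (THE P. is_orthogonal_projection P W)"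

definition P_add :: "('m::finite \<Rightarrow> real ^ 'd::finite) \<Rightarrow> ('m, 'd) full_matrix"
  where "P_add t = orthogonal_projection (F_add t)"

lemma subspace_F_add: "subspace (F_add t)"
proof (rule subspaceI)
  show "0 \<in> F_add t"
    by (auto simp: F_add_def additive_on_cube_def depends_only_on_cube_def
        intro!: exI[of _ "\<lambda>_ _. 0"])
next
  fix a b assume "a \<in> F_add t" "b \<in> F_add t"
  then obtain r q where r: "additive_on_cube (r None)"
      "\<And>k. depends_only_on_cube k (r (Some k))" "\<And>j l. a $ (j, l) = r l (t j)"
    and q: "additive_on_cube (q None)"
      "\<And>k. depends_only_on_cube k (q (Some k))" "\<And>j l. b $ (j, l) = q l (t j)"
    by (auto simp: F_add_def)
  from r(1) q(1) obtain f g where "\<forall>x\<in>cbox 0 1. r None x = (\<Sum>k\<in>UNIV. f k (x $ k))"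
    "\<forall>x\<in>cbox 0 1. q None x = (\<Sum>k\<in>UNIV. g k (x $ k))"
    by (auto simp: additive_on_cube_def)
  then have "additive_on_cube (\<lambda>x. r None x + q None x)"
    by (auto simp: additive_on_cube_def sum.distrib intro!: exI[of _ "\<lambda>k u. f k u + g k u"])
  moreover have "depends_only_on_cube k (\<lambda>x. r (Some k) x + q (Some k) x)" for k
  proof -
    from r(2)[of k] q(2)[of k] obtain f g where "\<forall>x\<in>cbox 0 1. r (Some k) x = f (x $ k)"
      "\<forall>x\<in>cbox 0 1. q (Some k) x = g (x $ k)"
      by (auto simp: depends_only_on_cube_def)
    then show ?thesis
      by (auto simp: depends_only_on_cube_def intro!: exI[of _ "\<lambda>u. f u + g u"])
  qed
  ultimately show "a + b \<in> F_add t"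
    using r(3) q(3) by (auto simp: F_add_def intro!: exI[of _ "\<lambda>l x. r l x + q l x"])
next
  fix c a assume "a \<in> F_add t"
  then obtain r where r: "additive_on_cube (r None)"
      "\<And>k. depends_only_on_cube k (r (Some k))" "\<And>j l. a $ (j, l) = r l (t j)"
    by (auto simp: F_add_def)
  from r(1) obtain f where "\<forall>x\<in>cbox 0 1. r None x = (\<Sum>k\<in>UNIV. f k (x $ k))"
    by (auto simp: additive_on_cube_def)
  then have "additive_on_cube (\<lambda>x. c * r None x)"
    by (auto simp: additive_on_cube_def sum_distrib_left intro!: exI[of _ "\<lambda>k u. c * f k u"])
  moreover have "depends_only_on_cube k (\<lambda>x. c * r (Some k) x)" for k
  proof -
    from r(2)[of k] obtain f where "\<forall>x\<in>cbox 0 1. r (Some k) x = f (x $ k)"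
      by (auto simp: depends_only_on_cube_def)
    then show ?thesis
      by (auto simp: depends_only_on_cube_def intro!: exI[of _ "\<lambda>u. c * f u"])
  qed
  ultimately show "c *\<^sub>R a \<in> F_add t"
    using r(3) by (auto simp: F_add_def intro!: exI[of _ "\<lambda>l x. c * r l x"])
qed

lemma orthogonal_decomp_unique:
  assumes "subspace W" "y \<in> W" "y' \<in> W"
    "\<And>w. w \<in> W \<Longrightarrow> orthogonal (x - y) w" "\<And>w. w \<in> W \<Longrightarrow> orthogonal (x - y') w"
  shows "y = y'"
proof -
  have *: "y' - y \<in> W"
    using assms by (simp add: subspace_diff)
  have "(y' - y) \<bullet> (y' - y) = (x - y) \<bullet> (y' - y) - (x - y') \<bullet> (y' - y)"
    by (simp add: inner_diff_left)
  also have "\<dots> = 0"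
    using assms(4)[OF *] assms(5)[OF *] by (simp add: orthogonal_def)
  finally show ?thesis by simp
qed

lemma ex1_orthogonal_projection:
  fixes W :: "(real ^ 'a::finite) set"
  assumes W: "subspace W"
  shows "\<exists>!P. is_orthogonal_projection P W"
proof -
  have "\<exists>y. y \<in> W \<and> (\<forall>w\<in>W. orthogonal (x - y) w)" for x
  proof -
    obtain y z where "y \<in> span W" "\<And>w. w \<in> span W \<Longrightarrow> orthogonal z w" "x = y + z"
      using orthogonal_subspace_decomp_exists[of W x] by blast
    with W show ?thesis
      by (auto simp: span_eq_iff[THEN iffD2] intro!: exI[of _ y])
  qed
  then obtain p where p: "\<And>x. p x \<in> W" "\<And>x w. w \<in> W \<Longrightarrow> orthogonal (x - p x) w"
    by metis
  have "linear p"
  proof (rule linearI)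
    fix x y
    show "p (x + y) = p x + p y"
    proof (rule orthogonal_decomp_unique[OF W, of _ _ "x + y"])
      show "orthogonal (x + y - (p x + p y)) w" if "w \<in> W" for w
        using p(2)[OF that, of x] p(2)[OF that, of y]
        by (simp add: orthogonal_def inner_diff_left inner_add_left)
    qed (use p W in \<open>auto intro: subspace_add\<close>)
  next
    fix c x
    show "p (c *\<^sub>R x) = c *\<^sub>R p x"
    proof (rule orthogonal_decomp_unique[OF W, of _ _ "c *\<^sub>R x"])
      show "orthogonal (c *\<^sub>R x - c *\<^sub>R p x) w" if "w \<in> W" for w
        using p(2)[OF that, of x] by (simp add: orthogonal_def inner_diff_left)
    qed (use p W in \<open>auto intro: subspace_scale\<close>)
  qed
  then have mp: "matrix p *v x = p x" for x
    by simp
  show ?thesis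
  proof (rule ex1I[of _ "matrix p"])
    show "is_orthogonal_projection (matrix p) W"
      using p by (simp add: is_orthogonal_projection_def mp)
  next
    fix P assume "is_orthogonal_projection P W"
    then have "P *v x = matrix p *v x" for x
      using orthogonal_decomp_unique[OF W, of "P *v x" "p x" x] p
      by (simp add: is_orthogonal_projection_def mp)
    then show "P = matrix p"
      by (simp add: matrix_eq)
  qed
qed

lemma is_orthogonal_projection_P_add: "is_orthogonal_projection (P_add t) (F_add t)"
  unfolding P_add_def orthogonal_projection_def
  by (rule theI') (rule ex1_orthogonal_projection[OF subspace_F_add])


subsection \<open>The local linear estimator\<close>

text \<open>
  Throughout, \<open>X i\<close>, \<open>Y i\<close> are the data, \<open>h k\<close> the bandwidths, \<open>K (X i) x\<close> the kernel weights
  (for the given bandwidths), and \<open>t j\<close> the grid points.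
\<close>

fun regressor :: "('n \<Rightarrow> real ^ 'd) \<Rightarrow> ('d \<Rightarrow> real) \<Rightarrow> 'n \<Rightarrow> 'd::finite option \<Rightarrow> real ^ 'd \<Rightarrow> real"
  where
    "regressor X h i None x = 1"
  | "regressor X h i (Some k) x = (X i $ k - x $ k) / h k"

definition SSR ::
    "('n::finite \<Rightarrow> real ^ 'd::finite) \<Rightarrow> ('n \<Rightarrow> real) \<Rightarrow> (real ^ 'd \<Rightarrow> real ^ 'd \<Rightarrow> real) \<Rightarrow>
     ('d \<Rightarrow> real) \<Rightarrow> real ^ ('d option) \<Rightarrow> real ^ 'd \<Rightarrow> real"
  where "SSR X Y K h b x = 1 / real CARD('n) *
    (\<Sum>i\<in>UNIV. (Y i - b $ None - (\<Sum>k\<in>UNIV. b $ Some k * ((X i $ k - x $ k) / h k)))\<^sup>2 * K (X i) x)"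

definition S_block ::
    "('n::finite \<Rightarrow> real ^ 'd::finite) \<Rightarrow> (real ^ 'd \<Rightarrow> real ^ 'd \<Rightarrow> real) \<Rightarrow> ('d \<Rightarrow> real) \<Rightarrow>
     real ^ 'd \<Rightarrow> real ^ ('d option) ^ ('d option)"
  where "S_block X K h x = (\<chi> l l'. 1 / real CARD('n) *
    (\<Sum>i\<in>UNIV. K (X i) x * regressor X h i l x * regressor X h i l' x))"

definition L_block ::
    "('n::finite \<Rightarrow> real ^ 'd::finite) \<Rightarrow> ('n \<Rightarrow> real) \<Rightarrow> (real ^ 'd \<Rightarrow> real ^ 'd \<Rightarrow> real) \<Rightarrow>
     ('d \<Rightarrow> real) \<Rightarrow> real ^ 'd \<Rightarrow> real ^ ('d option)"
  where "L_block X Y K h x = (\<chi> l. 1 / real CARD('n) *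
    (\<Sum>i\<in>UNIV. K (X i) x * regressor X h i l x * Y i))"

definition S_mat ::
    "('n::finite \<Rightarrow> real ^ 'd::finite) \<Rightarrow> (real ^ 'd \<Rightarrow> real ^ 'd \<Rightarrow> real) \<Rightarrow> ('d \<Rightarrow> real) \<Rightarrow>
     ('m::finite \<Rightarrow> real ^ 'd) \<Rightarrow> ('m, 'd) full_matrix"
  where "S_mat X K h t = (\<chi> a b.
    if fst a = fst b then S_block X K h (t (fst a)) $ snd a $ snd b else 0)"

definition L_vec ::
    "('n::finite \<Rightarrow> real ^ 'd::finite) \<Rightarrow> ('n \<Rightarrow> real) \<Rightarrow> (real ^ 'd \<Rightarrow> real ^ 'd \<Rightarrow> real) \<Rightarrow>
     ('d \<Rightarrow> real) \<Rightarrow> ('m::finite \<Rightarrow> real ^ 'd) \<Rightarrow> ('m, 'd) full"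
  where "L_vec X Y K h t = (\<chi> a. L_block X Y K h (t (fst a)) $ snd a)"

text \<open>
  The local minimizers need not be unique, so being a local linear estimator is a predicate.
\<close>

definition is_local_linear_estimator ::
    "('n::finite \<Rightarrow> real ^ 'd::finite) \<Rightarrow> ('n \<Rightarrow> real) \<Rightarrow> (real ^ 'd \<Rightarrow> real ^ 'd \<Rightarrow> real) \<Rightarrow>
     ('d \<Rightarrow> real) \<Rightarrow> ('m::finite \<Rightarrow> real ^ 'd) \<Rightarrow> ('m, 'd) full \<Rightarrow> bool"
  where "is_local_linear_estimator X Y K h t b \<longleftrightarrow>
    (\<forall>j. is_arg_min (\<lambda>c. SSR X Y K h c (t j)) (\<lambda>_. True) (block b j))"


subsection \<open>The oblique projection\<close>

definition is_generalized_inverse :: "real ^ 'a ^ 'b \<Rightarrow> real ^ 'b ^ 'a \<Rightarrow> bool"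
  where "is_generalized_inverse M G \<longleftrightarrow> M ** G ** M = M"

definition A_mat ::
    "('n::finite \<Rightarrow> real ^ 'd::finite) \<Rightarrow> (real ^ 'd \<Rightarrow> real ^ 'd \<Rightarrow> real) \<Rightarrow> ('d \<Rightarrow> real) \<Rightarrow>
     ('m::finite \<Rightarrow> real ^ 'd) \<Rightarrow> real \<Rightarrow> ('m, 'd) full_matrix"
  where "A_mat X K h t R = R *\<^sub>R matrix_inv (S_mat X K h t + R *\<^sub>R mat 1)"

definition braces_mat :: "real ^ 'a ^ 'a \<Rightarrow> real ^ 'a::finite ^ 'p::finite \<Rightarrow> real ^ 'p ^ 'p"
  where "braces_mat A Z =
    (mat 1 - Z ** transpose Z) + Z ** (mat 1 - A) ** transpose Z"

text \<open>\<open>G\<close> stands for the chosen generalized inverse of \<^term>\<open>braces_mat A Z\<close>.\<close>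

definition P_oblique ::
    "real ^ 'a ^ 'a \<Rightarrow> real ^ 'a::finite ^ 'p::finite \<Rightarrow> real ^ 'p ^ 'p \<Rightarrow> real ^ 'a ^ 'a"
  where "P_oblique A Z G = transpose Z ** G ** Z ** (mat 1 - A)"


subsection \<open>The penalized estimator\<close>

definition penalized_criterion ::
    "('n::finite \<Rightarrow> real ^ 'd::finite) \<Rightarrow> ('n \<Rightarrow> real) \<Rightarrow> (real ^ 'd \<Rightarrow> real ^ 'd \<Rightarrow> real) \<Rightarrow>
     ('d \<Rightarrow> real) \<Rightarrow> ('m::finite \<Rightarrow> real ^ 'd) \<Rightarrow> real \<Rightarrow> ('m, 'd) full \<Rightarrow> real"
  where "penalized_criterion X Y K h t R b =
    (\<Sum>j\<in>UNIV. SSR X Y K h (block b j) (t j)) + R * (norm ((mat 1 - P_add t) *v b))\<^sup>2"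

definition penalized_solution ::
    "('n::finite \<Rightarrow> real ^ 'd::finite) \<Rightarrow> ('n \<Rightarrow> real) \<Rightarrow> (real ^ 'd \<Rightarrow> real ^ 'd \<Rightarrow> real) \<Rightarrow>
     ('d \<Rightarrow> real) \<Rightarrow> ('m::finite \<Rightarrow> real ^ 'd) \<Rightarrow> real \<Rightarrow>
     real ^ ('m \<times> 'd option) ^ 'p::finite \<Rightarrow> real ^ 'p ^ 'p \<Rightarrow> ('m, 'd) full"
  where "penalized_solution X Y K h t R Z G =
    (mat 1 + A_mat X K h t R ** transpose Z ** G ** Z) *v
      (matrix_inv (S_mat X K h t + R *\<^sub>R mat 1) *v L_vec X Y K h t)"

text \<open>
  The criterion always has a minimizer, but possibly several; in that case the estimator is the
  one given by the explicit solution formula for the chosen generalized inverse \<open>G\<close>.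
\<close>

definition penalized_estimator ::
    "('n::finite \<Rightarrow> real ^ 'd::finite) \<Rightarrow> ('n \<Rightarrow> real) \<Rightarrow> (real ^ 'd \<Rightarrow> real ^ 'd \<Rightarrow> real) \<Rightarrow>
     ('d \<Rightarrow> real) \<Rightarrow> ('m::finite \<Rightarrow> real ^ 'd) \<Rightarrow> real \<Rightarrow>
     real ^ ('m \<times> 'd option) ^ 'p::finite \<Rightarrow> real ^ 'p ^ 'p \<Rightarrow> ('m, 'd) full"
  where "penalized_estimator X Y K h t R Z G =
    (if \<exists>!b. is_arg_min (penalized_criterion X Y K h t R) (\<lambda>_. True) b
     then arg_min (penalized_criterion X Y K h t R) (\<lambda>_. True)
     else penalized_solution X Y K h t R Z G)"

end

theory Submission
  imports Defs
begin

text \<open>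
  Write \<open>B = S + R I\<close>, so that \<open>I - A = B\<^sup>-\<^sup>1 S\<close>, and \<open>M = I - Z A Z\<^sup>T\<close>. Since
  \<open>S \<beta>\<^sub>l\<^sub>l = L\<close>, the solution formula reads \<open>\<beta>\<^sub>R = q + A v\<close> with \<open>q = (I - A) \<beta>\<^sub>l\<^sub>l\<close> and
  \<open>v = Z\<^sup>T G Z q\<close>, the oblique projection of \<open>\<beta>\<^sub>l\<^sub>l\<close>. The point is that \<open>M G\<close> fixes \<open>Z q\<close>: a
  vector \<open>w\<close> in the kernel of \<open>M\<close> satisfies \<open>(I - A) Z\<^sup>T w = 0\<close>, because \<open>I - A\<close> is positive
  semidefinite, so \<open>Z q\<close> is orthogonal to the kernel of the symmetric matrix \<open>M\<close>, whatever
  \<open>\<beta>\<^sub>l\<^sub>l\<close> and \<open>G\<close> are. Hence \<open>P \<beta>\<^sub>R = Z\<^sup>T (Z q + Z A v) = v\<close>, and both relations follow, as do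
  the normal equations for \<open>\<beta>\<^sub>R\<close>, which show that the formula yields a minimizer also when the
  minimizer is unique.
\<close>

subsection \<open>Symmetric and positive semidefinite matrices\<close>

text \<open>Keeps \<open>transpose A *v x\<close> from becoming \<open>x v* A\<close>, so that
  adjoints can be moved across inner products.\<close>

declare transpose_matrix_vector [simp del]

definition psd_matrix :: "real ^ 'a ^ 'a::finite \<Rightarrow> bool"
  where "psd_matrix H \<longleftrightarrow> transpose H = H \<and> (\<forall>x. 0 \<le> x \<bullet> (H *v x))"

lemma inner_transpose_matrix_vector:
  fixes A :: "real ^ 'a::finite ^ 'b::finite"
  shows "x \<bullet> (transpose A *v y) = (A *v x) \<bullet> y"
  by (metis dot_lmul_matrix inner_commute transpose_matrix_vector)

lemma symmetric_matrix_inner: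
  fixes H :: "real ^ 'a::finite ^ 'a"
  assumes "transpose H = H"
  shows "x \<bullet> (H *v y) = (H *v x) \<bullet> y"
  using inner_transpose_matrix_vector[of x H y] assms by simp

lemma transpose_eqI:
  fixes H :: "real ^ 'a::finite ^ 'a"
  assumes "\<And>x y. x \<bullet> (H *v y) = (H *v x) \<bullet> y"
  shows "transpose H = H"
proof -
  have "x \<bullet> (transpose H *v y) = x \<bullet> (H *v y)" for x y
    by (simp add: inner_transpose_matrix_vector assms)
  then have "transpose H *v y = H *v y" for y
    by (metis vector_eq_ldot)
  then show ?thesis
    by (simp add: matrix_eq)
qed

text \<open>The objective at \<open>x + z\<close> exceeds that at \<open>x\<close> by 2 z.(Hx - L) +
  z.Hz. The linear term must vanish at a minimizer, and once it does the rest is nonnegative.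
  \<open>H\<close> may be singular, so non-unique minimizers are covered.\<close>

lemma quadratic_minimizer_iff:
  fixes H :: "real ^ 'a::finite ^ 'a"
  assumes "psd_matrix H"
  shows "(\<forall>y. x \<bullet> (H *v x) - 2 * (L \<bullet> x) \<le> y \<bullet> (H *v y) - 2 * (L \<bullet> y)) \<longleftrightarrow> H *v x = L"
proof -
  have psd: "0 \<le> z \<bullet> (H *v z)" for z
    using assms by (simp add: psd_matrix_def)
  have sym: "y \<bullet> (H *v z) = (H *v y) \<bullet> z" for y z
    using assms by (intro symmetric_matrix_inner) (simp add: psd_matrix_def)
  define f where "f y = y \<bullet> (H *v y) - 2 * (L \<bullet> y)" for y
  have expand: "f (x + z) = f x + 2 * (z \<bullet> (H *v x - L)) + z \<bullet> (H *v z)" for z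
    unfolding f_def using sym[of x z]
    by (simp add: algebra_simps inner_commute)
  have "H *v x = L" if min: "\<forall>y. f x \<le> f y"
  proof -
    define v where "v = H *v x - L"
    define c where "c = v \<bullet> (H *v v)"
    have c: "0 \<le> c"
      unfolding c_def by (rule psd)
    \<comment> \<open>A step along the negative gradient. The 1 added to the curvature
      \<open>c\<close> keeps the denominator positive when \<open>c = 0\<close>, and the change in
      \<open>f\<close> is still negative unless \<open>v = 0\<close>.\<close>
    define s where "s = - (v \<bullet> v) / (c + 1)"
    have "0 \<le> 2 * s * (v \<bullet> v) + s * s * c"
      using min[rule_format, of "x + s *\<^sub>R v"] expand[of "s *\<^sub>R v"]
      by (simp add: v_def[symmetric] c_def matrix_vector_mult_scaleR)
    also have "\<dots> = - ((v \<bullet> v)\<^sup>2 * (c + 2) / (c + 1)\<^sup>2)"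
      using c unfolding s_def by (simp add: divide_simps power2_eq_square) (simp add: algebra_simps)
    finally have "(v \<bullet> v)\<^sup>2 * (c + 2) / (c + 1)\<^sup>2 \<le> 0"
      by simp
    then have "v = 0"
      using c by (auto simp: divide_le_0_iff mult_le_0_iff)
    then show ?thesis
      by (simp add: v_def)
  qed
  moreover have "f x \<le> f y" if "H *v x = L" for y
    using expand[of "y - x"] psd[of "y - x"] that by simp
  ultimately show ?thesis
    unfolding f_def by blast
qed

text \<open>Here \<open>x\<close> minimizes the form with linear part 0, so the gradient vanishes at
  \<open>x\<close>.\<close>

lemma psd_matrix_inner_eq_0:
  fixes H :: "real ^ 'a::finite ^ 'a"
  assumes "psd_matrix H" "x \<bullet> (H *v x) = 0"
  shows "H *v x = 0"
  using quadratic_minimizer_iff[OF assms(1), of x 0] assms by (simp add: psd_matrix_def)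

text \<open>For symmetric \<open>M\<close>, orthogonality to the kernel means lying in the range,
  where \<open>M ** G\<close> is the identity. Directly: NM = 0 for N = I - MG, so transposing puts
  the vector \<open>transpose N *v (N *v y)\<close> in the kernel, and its inner product with
  \<open>y\<close> is |Ny|^2.\<close>

lemma generalized_inverse_apply:
  fixes M :: "real ^ 'a::finite ^ 'a"
  assumes "transpose M = M" "is_generalized_inverse M G"
    and y: "\<And>w. M *v w = 0 \<Longrightarrow> y \<bullet> w = 0"
  shows "M *v (G *v y) = y"
proof -
  define N where "N = mat 1 - M ** G"
  have "N ** M = 0"
    using assms(2) unfolding N_def is_generalized_inverse_def
    by (simp add: matrix_eq matrix_vector_mul_assoc[symmetric] matrix_vector_mult_diff_rdistrib)
  have "M *v (transpose N *v z) = 0" for z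
  proof -
    have "M *v (transpose N *v z) = transpose (N ** M) *v z"
      by (simp add: matrix_transpose_mul assms(1) matrix_vector_mul_assoc)
    also have "\<dots> = 0"
      by (simp add: \<open>N ** M = 0\<close> transpose_matrix_vector)
    finally show ?thesis .
  qed
  then have "y \<bullet> (transpose N *v (N *v y)) = 0"
    by (rule y)
  then have "N *v y = 0"
    by (simp add: inner_transpose_matrix_vector)
  then show ?thesis
    by (simp add: N_def matrix_vector_mult_diff_rdistrib matrix_vector_mul_assoc)
qed

text \<open>The last claim writes the penalty as a quadratic form, by the orthogonality of x - Px
  and Px.\<close>

lemma psd_matrix_orthogonal_complement:
  assumes "is_orthogonal_projection P W" "transpose P = P"
  shows "P ** P = P" "psd_matrix (mat 1 - P)"
    "x \<bullet> ((mat 1 - P) *v x) = (norm ((mat 1 - P) *v x))\<^sup>2"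
proof -
  have P: "P *v v \<in> W" "w \<in> W \<Longrightarrow> (v - P *v v) \<bullet> w = 0" for v w
    using assms(1) by (auto simp: is_orthogonal_projection_def orthogonal_def)
  have sym: "x \<bullet> (P *v y) = (P *v x) \<bullet> y" for x y
    by (rule symmetric_matrix_inner[OF assms(2)])
  have "(x - P *v x) \<bullet> (P *v y) = 0" for x y
    using P by blast
  \<comment> \<open>Moving P to the left factor makes P(x - Px) orthogonal to every
    \<open>y\<close>, hence zero.\<close>
  then have "P *v (P *v x) = P *v x" for x
    using sym by (metis inner_commute inner_eq_zero_iff matrix_vector_mult_diff_distrib
        right_minus_eq)
  then show PP: "P ** P = P"
    by (simp add: matrix_eq matrix_vector_mul_assoc[symmetric])
  show eq: "x \<bullet> ((mat 1 - P) *v x) = (norm ((mat 1 - P) *v x))\<^sup>2" for x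
    using P(2)[OF P(1), of x x]
    by (simp add: power2_norm_eq_inner matrix_vector_mult_diff_rdistrib inner_diff_left
        inner_diff_right inner_commute)
  have "transpose (mat 1 - P) = mat 1 - P"
    by (rule transpose_eqI) (simp add: matrix_vector_mult_diff_rdistrib inner_diff_left
        inner_diff_right sym)
  then show "psd_matrix (mat 1 - P)"
    by (simp add: psd_matrix_def eq)
qed

text \<open>\<open>Z\<close> vanishes on the kernel of its Gram matrix \<open>P\<close>, and x - Px
  lies in that kernel.\<close>

lemma mult_transpose_mult_eq:
  fixes Z :: "real ^ 'a::finite ^ 'p::finite"
  assumes "transpose Z ** Z = P" "P ** P = P"
  shows "Z *v (P *v x) = Z *v x"
proof -
  have ZZ: "transpose Z *v (Z *v y) = P *v y" for y
    by (simp add: matrix_vector_mul_assoc assms(1))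
  have "(Z *v (x - P *v x)) \<bullet> (Z *v (x - P *v x)) = (x - P *v x) \<bullet> (P *v (x - P *v x))"
    by (simp add: ZZ[symmetric] inner_transpose_matrix_vector)
  also have "P *v (x - P *v x) = 0"
    by (simp add: matrix_vector_mult_diff_distrib matrix_vector_mul_assoc assms(2))
  finally show ?thesis
    by (simp add: matrix_vector_mult_diff_distrib)
qed


subsection \<open>The shrinkage matrix and the oblique projection\<close>

text \<open>B is invertible because x.Bx is at least R|x|^2, and multiplying S = B - RI by the
  inverse gives I - A.\<close>

lemma
  fixes S :: "real ^ 'a::finite ^ 'a"
  assumes S: "psd_matrix S" and R: "R > 0"
  defines "B \<equiv> S + R *\<^sub>R mat 1"
  defines "A \<equiv> R *\<^sub>R matrix_inv B"
  shows ridge_inverse: "B *v (matrix_inv B *v x) = x"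
    and shrinkage_apply: "matrix_inv B *v (S *v x) = (mat 1 - A) *v x"
    and psd_shrinkage: "psd_matrix (mat 1 - A)"
proof -
  have Bv: "B *v x = S *v x + R *\<^sub>R x" for x
    by (simp add: B_def matrix_vector_mult_add_rdistrib scaleR_matrix_vector_assoc[symmetric])
  have "x = 0" if "B *v x = 0" for x
  proof -
    have "x \<bullet> (B *v x) = x \<bullet> (S *v x) + R * (x \<bullet> x)"
      by (simp add: Bv inner_add_right)
    moreover have "0 \<le> x \<bullet> (S *v x)"
      using S by (simp add: psd_matrix_def)
    ultimately have "R * (x \<bullet> x) \<le> 0"
      using that by simp
    with R have "x \<bullet> x \<le> 0"
      by (simp add: mult_le_0_iff)
    then show ?thesis
      by (metis inner_eq_zero_iff inner_ge_zero order_antisym)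
  qed
  then have "invertible B"
    by (simp add: invertible_left_inverse matrix_left_invertible_ker)
  then have "B ** matrix_inv B = mat 1 \<and> matrix_inv B ** B = mat 1"
    unfolding invertible_def matrix_inv_def by (rule someI_ex)
  then have inv: "B *v (matrix_inv B *v x) = x" "matrix_inv B *v (B *v x) = x" for x
    by (simp_all add: matrix_vector_mul_assoc)
  show "B *v (matrix_inv B *v x) = x"
    by (rule inv)
  have Av: "A *v x = R *\<^sub>R (matrix_inv B *v x)" for x
    by (simp add: A_def scaleR_matrix_vector_assoc[symmetric])
  have "matrix_inv B *v (S *v x) + A *v x = x"
    using inv(2)[of x] by (simp add: Bv matrix_vector_right_distrib matrix_vector_mult_scaleR Av)
  then show "matrix_inv B *v (S *v x) = (mat 1 - A) *v x"
    by (simp add: matrix_vector_mult_diff_rdistrib eq_diff_eq)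
  have symS: "x \<bullet> (S *v y) = (S *v x) \<bullet> y" for x y
    using S by (intro symmetric_matrix_inner) (simp add: psd_matrix_def)
  have symB: "x \<bullet> (B *v y) = (B *v x) \<bullet> y" for x y
    by (simp add: Bv inner_add_left inner_add_right symS)
  \<comment> \<open>Symmetry and positivity of I - A are tested on vectors \<open>B *v y\<close>,
    which exhaust the space. There I - A acts as S, and the form becomes |Sy|^2 + R y.Sy.\<close>
  have IA: "(mat 1 - A) *v (B *v y) = S *v y" for y
    by (simp add: matrix_vector_mult_diff_rdistrib Av inv) (simp add: Bv)
  have "(B *v x) \<bullet> ((mat 1 - A) *v (B *v y)) = ((mat 1 - A) *v (B *v x)) \<bullet> (B *v y)" for x y
    by (simp add: IA) (simp add: Bv inner_add_left inner_add_right symS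
        matrix_vector_right_distrib matrix_vector_mult_scaleR)
  then have "transpose (mat 1 - A) = mat 1 - A"
    by (intro transpose_eqI) (metis inv(1))
  moreover have "0 \<le> (B *v y) \<bullet> ((mat 1 - A) *v (B *v y))" for y
    using S R by (simp add: IA) (simp add: Bv inner_add_left psd_matrix_def)
  then have "0 \<le> x \<bullet> ((mat 1 - A) *v x)" for x
    by (metis inv(1))
  ultimately show "psd_matrix (mat 1 - A)"
    by (simp add: psd_matrix_def)
qed

text \<open>If \<open>w\<close> is in the kernel of M and u = \<open>transpose Z *v w\<close>, then
  0 = w.Mw = |w - Zu|^2 + u.(I - A)u. Both terms are nonnegative, so (I - A)u = 0, and the inner
  product of Z(I - A)b with \<open>w\<close> is b.(I - A)u = 0.\<close>

lemma braces_generalized_inverse: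
  fixes Z :: "real ^ 'a::finite ^ 'p::finite"
  assumes ZZ: "transpose Z ** Z = P" and PP: "P ** P = P"
    and psd: "psd_matrix (mat 1 - A)"
    and G: "is_generalized_inverse (braces_mat A Z) G"
  shows "braces_mat A Z *v (G *v (Z *v ((mat 1 - A) *v b))) = Z *v ((mat 1 - A) *v b)"
proof (rule generalized_inverse_apply[OF _ G])
  define H where "H = mat 1 - A"
  have symH: "x \<bullet> (H *v y) = (H *v x) \<bullet> y" for x y
    using psd by (intro symmetric_matrix_inner) (simp add: psd_matrix_def H_def)
  have Mv: "braces_mat A Z *v w
      = w - Z *v (transpose Z *v w) + Z *v (H *v (transpose Z *v w))" for w
    unfolding braces_mat_def H_def[symmetric]
    by (simp add: matrix_vector_mult_add_rdistrib matrix_vector_mult_diff_rdistrib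
        matrix_vector_mul_assoc[symmetric])
  have Zin: "x \<bullet> (Z *v y) = (transpose Z *v x) \<bullet> y" for x y
    using inner_transpose_matrix_vector[of y Z x] by (simp add: inner_commute)
  show "transpose (braces_mat A Z) = braces_mat A Z"
  proof (rule transpose_eqI)
    show "x \<bullet> (braces_mat A Z *v y) = (braces_mat A Z *v x) \<bullet> y" for x y
      using Zin[of y] symH
      by (simp add: Mv inner_add_left inner_add_right inner_diff_left inner_diff_right Zin
          inner_commute)
  qed
  \<comment> \<open>The adjoint of ZP = Z; it gives |Zu|^2 = |u|^2 when the square |w - Zu|^2 is
    expanded.\<close>
  have ZtZ: "transpose Z *v (Z *v (transpose Z *v w)) = transpose Z *v w" for w
  proof -
    have "x \<bullet> (transpose Z *v (Z *v (transpose Z *v w))) = x \<bullet> (transpose Z *v w)" for x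
    proof -
      have "x \<bullet> (transpose Z *v (Z *v (transpose Z *v w)))
          = (Z *v (transpose Z *v (Z *v x))) \<bullet> w"
        by (simp only: inner_transpose_matrix_vector Zin)
      also have "transpose Z *v (Z *v x) = P *v x"
        by (simp add: matrix_vector_mul_assoc ZZ)
      finally show ?thesis
        by (simp add: mult_transpose_mult_eq[OF ZZ PP] inner_transpose_matrix_vector)
    qed
    then show ?thesis
      by (metis vector_eq_ldot)
  qed
  fix w assume w: "braces_mat A Z *v w = 0"
  define u where "u = transpose Z *v w"
  have "0 = w \<bullet> (braces_mat A Z *v w)"
    by (simp add: w)
  also have "\<dots> = w \<bullet> w - u \<bullet> u + u \<bullet> (H *v u)"
    by (simp add: Mv u_def inner_add_right inner_diff_right Zin)
  also have "w \<bullet> w - u \<bullet> u = (norm (w - Z *v u))\<^sup>2"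
    using Zin[of w u] Zin[of "Z *v u" u] ZtZ[of w]
    by (simp add: power2_norm_eq_inner inner_diff_left inner_diff_right u_def[symmetric]
        inner_commute)
  finally have "u \<bullet> (H *v u) \<le> 0"
    using zero_le_power2[of "norm (w - Z *v u)"] by linarith
  then have "H *v u = 0"
    using psd by (intro psd_matrix_inner_eq_0) (auto simp: psd_matrix_def H_def intro: antisym)
  then have "(Z *v (H *v b)) \<bullet> w = 0"
    using Zin[of w "H *v b"] symH[of u b] by (simp add: inner_commute u_def[symmetric])
  then show "(Z *v ((mat 1 - A) *v b)) \<bullet> w = 0"
    by (simp add: H_def)
qed

text \<open>With g = GZq the previous lemma reads Zq = Mg, that is, \<open>Z\<close> maps q + Av to
  \<open>g\<close>. Applying \<open>transpose Z\<close> produces \<open>P\<close> on the left and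
  the oblique projection v on the right.\<close>

lemma oblique_solution:
  fixes Z :: "real ^ 'a::finite ^ 'p::finite"
  assumes ZZ: "transpose Z ** Z = P" and PP: "P ** P = P"
    and psd: "psd_matrix (mat 1 - A)"
    and G: "is_generalized_inverse (braces_mat A Z) G"
  shows "P *v ((mat 1 - A) *v b + A *v (P_oblique A Z G *v b)) = P_oblique A Z G *v b"
proof -
  define q where "q = (mat 1 - A) *v b"
  define g where "g = G *v (Z *v q)"
  have v: "P_oblique A Z G *v b = transpose Z *v g"
    by (simp add: P_oblique_def q_def g_def matrix_vector_mul_assoc[symmetric])
  have "Z *v q = braces_mat A Z *v g"
    using braces_generalized_inverse[OF assms] by (simp add: g_def q_def)
  also have "\<dots> = g - Z *v (A *v (transpose Z *v g))"
    by (simp add: braces_mat_def matrix_vector_mult_add_rdistrib matrix_vector_mult_diff_rdistrib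
        matrix_vector_mult_diff_distrib matrix_vector_mul_assoc[symmetric])
  finally have "Z *v (q + A *v (transpose Z *v g)) = g"
    by (simp add: matrix_vector_right_distrib)
  then have "transpose Z *v (Z *v (q + A *v (transpose Z *v g))) = transpose Z *v g"
    by simp
  then show ?thesis
    by (simp add: v q_def[symmetric] matrix_vector_mul_assoc ZZ)
qed


subsection \<open>The least squares criteria as quadratic forms\<close>

lemma sum_UNIV_option:
  fixes f :: "'a::finite option \<Rightarrow> 'b::comm_monoid_add"
  shows "(\<Sum>l\<in>UNIV. f l) = f None + (\<Sum>k\<in>UNIV. f (Some k))"
  by (simp add: UNIV_option_conv sum.reindex)

text \<open>A row of the local design matrix: the local residual becomes \<open>Y i\<close> minus an
  inner product, and the blocks of S become weighted Gram matrices.\<close>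

definition regressors ::
    "('n \<Rightarrow> real ^ 'd::finite) \<Rightarrow> ('d \<Rightarrow> real) \<Rightarrow> 'n \<Rightarrow> real ^ 'd \<Rightarrow> real ^ ('d option)"
  where "regressors X h i x = (\<chi> l. regressor X h i l x)"

lemma SSR_residual:
  "Y i - c $ None - (\<Sum>k\<in>UNIV. c $ Some k * ((X i $ k - x $ k) / h k))
    = Y i - regressors X h i x \<bullet> c"
  by (simp add: regressors_def inner_vec_def sum_UNIV_option mult.commute)

lemma S_block_mult:
  fixes X :: "'n::finite \<Rightarrow> real ^ 'd::finite"
  shows "S_block X K h x *v c = (1 / real CARD('n)) *\<^sub>R
    (\<Sum>i\<in>UNIV. (K (X i) x * (regressors X h i x \<bullet> c)) *\<^sub>R regressors X h i x)"
proof (rule vec_eq_iff[THEN iffD2], rule allI)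
  fix l
  have "(S_block X K h x *v c) $ l = (\<Sum>l'\<in>UNIV. \<Sum>i\<in>UNIV. 1 / real CARD('n) *
      (K (X i) x * regressor X h i l x * regressor X h i l' x) * c $ l')"
    by (simp add: S_block_def matrix_vector_mult_def sum_distrib_left sum_distrib_right)
  also have "\<dots> = (\<Sum>i\<in>UNIV. \<Sum>l'\<in>UNIV. 1 / real CARD('n) *
      (K (X i) x * regressor X h i l x * regressor X h i l' x) * c $ l')"
    by (rule sum.swap)
  finally show "(S_block X K h x *v c) $ l = ((1 / real CARD('n)) *\<^sub>R
      (\<Sum>i\<in>UNIV. (K (X i) x * (regressors X h i x \<bullet> c)) *\<^sub>R regressors X h i x)) $ l"
    by (simp add: regressors_def inner_vec_def sum_distrib_left sum_distrib_right mult_ac)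
qed

text \<open>The right-hand side is symmetric in \<open>c\<close> and \<open>c'\<close>, and for
  \<open>c' = c\<close> a weighted sum of squares; this is what makes S positive
  semidefinite.\<close>

lemma S_block_inner:
  fixes X :: "'n::finite \<Rightarrow> real ^ 'd::finite"
  shows "c' \<bullet> (S_block X K h x *v c) = 1 / real CARD('n) *
    (\<Sum>i\<in>UNIV. K (X i) x * ((regressors X h i x \<bullet> c) * (regressors X h i x \<bullet> c')))"
  by (simp add: S_block_mult inner_sum_right inner_commute mult_ac)

lemma L_block_inner:
  fixes X :: "'n::finite \<Rightarrow> real ^ 'd::finite"
  shows "L_block X Y K h x \<bullet> c = 1 / real CARD('n) *
    (\<Sum>i\<in>UNIV. K (X i) x * (Y i * (regressors X h i x \<bullet> c)))"
proof -
  have "L_block X Y K h x = (1 / real CARD('n)) *\<^sub>R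
      (\<Sum>i\<in>UNIV. (K (X i) x * Y i) *\<^sub>R regressors X h i x)"
    by (simp add: vec_eq_iff L_block_def regressors_def mult_ac)
  then show ?thesis
    by (simp add: inner_sum_left mult_ac)
qed

lemma SSR_quadratic:
  fixes X :: "'n::finite \<Rightarrow> real ^ 'd::finite"
  shows "SSR X Y K h c x = 1 / real CARD('n) * (\<Sum>i\<in>UNIV. K (X i) x * (Y i)\<^sup>2)
    + (c \<bullet> (S_block X K h x *v c) - 2 * (L_block X Y K h x \<bullet> c))"
proof -
  have "SSR X Y K h c x = 1 / real CARD('n) * (\<Sum>i\<in>UNIV. K (X i) x * (Y i)\<^sup>2
      + (K (X i) x * ((regressors X h i x \<bullet> c) * (regressors X h i x \<bullet> c))
      - 2 * (K (X i) x * (Y i * (regressors X h i x \<bullet> c)))))"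
    unfolding SSR_def SSR_residual
    by (intro arg_cong2[where f = "(*)"] sum.cong refl) (simp add: power2_eq_square algebra_simps)
  also have "\<dots> = 1 / real CARD('n) * (\<Sum>i\<in>UNIV. K (X i) x * (Y i)\<^sup>2)
    + (c \<bullet> (S_block X K h x *v c) - 2 * (L_block X Y K h x \<bullet> c))"
    unfolding S_block_inner L_block_inner sum.distrib sum_subtractf sum_distrib_left[symmetric]
    by (simp add: algebra_simps)
  finally show ?thesis .
qed

section \<open>Stacking the local criteria over the grid points\<close>

lemma sum_UNIV_prod:
  fixes f :: "'a::finite \<times> 'b::finite \<Rightarrow> 'c::comm_monoid_add"
  shows "(\<Sum>a\<in>UNIV. f a) = (\<Sum>j\<in>UNIV. \<Sum>l\<in>UNIV. f (j, l))"
  by (simp add: sum.cartesian_product)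

lemma inner_block: "b \<bullet> c = (\<Sum>j\<in>UNIV. block b j \<bullet> block c j)"
  by (simp add: inner_vec_def block_def sum_UNIV_prod)

lemma block_S_mat: "block (S_mat X K h t *v b) j = S_block X K h (t j) *v block b j"
proof (rule vec_eq_iff[THEN iffD2], rule allI)
  fix l
  have "block (S_mat X K h t *v b) j $ l = (\<Sum>j'\<in>UNIV. \<Sum>l'\<in>UNIV.
      (if j = j' then S_block X K h (t j) $ l $ l' else 0) * b $ (j', l'))"
    by (simp add: block_def S_mat_def matrix_vector_mult_def sum_UNIV_prod cong: if_cong)
  also have "\<dots> = (\<Sum>j'\<in>UNIV. if j' = j then
      (\<Sum>l'\<in>UNIV. S_block X K h (t j) $ l $ l' * b $ (j, l')) else 0)"
    by (rule sum.cong) auto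
  finally show "block (S_mat X K h t *v b) j $ l = (S_block X K h (t j) *v block b j) $ l"
    by (simp add: block_def matrix_vector_mult_def)
qed

lemma block_L_vec: "block (L_vec X Y K h t) j = L_block X Y K h (t j)"
  by (simp add: vec_eq_iff block_def L_vec_def)

text \<open>The constant is left unnamed: for minimization only its independence of \<open>b\<close>
  matters.\<close>

lemma sum_SSR_quadratic:
  fixes X :: "'n::finite \<Rightarrow> real ^ 'd::finite" and t :: "'m::finite \<Rightarrow> real ^ 'd"
  obtains C where "\<And>b. (\<Sum>j\<in>UNIV. SSR X Y K h (block b j) (t j))
    = C + (b \<bullet> (S_mat X K h t *v b) - 2 * (L_vec X Y K h t \<bullet> b))"
proof
  fix b
  show "(\<Sum>j\<in>UNIV. SSR X Y K h (block b j) (t j))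
    = (\<Sum>j\<in>UNIV. 1 / real CARD('n) * (\<Sum>i\<in>UNIV. K (X i) (t j) * (Y i)\<^sup>2))
      + (b \<bullet> (S_mat X K h t *v b) - 2 * (L_vec X Y K h t \<bullet> b))"
    unfolding inner_block block_S_mat block_L_vec SSR_quadratic
    by (simp add: sum.distrib sum_subtractf sum_distrib_left)
qed

lemma psd_S_mat:
  assumes "\<And>i j. K (X i) (t j) \<ge> 0"
  shows "psd_matrix (S_mat X K h t)"
proof -
  have "x \<bullet> (S_mat X K h t *v y) = (S_mat X K h t *v x) \<bullet> y" for x y
    unfolding inner_commute[of "S_mat X K h t *v x"] unfolding inner_block block_S_mat S_block_inner
    by (simp add: mult_ac)
  moreover have "0 \<le> x \<bullet> (S_mat X K h t *v x)" for x
    unfolding inner_block block_S_mat S_block_inner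
    by (auto intro!: sum_nonneg divide_nonneg_nonneg mult_nonneg_nonneg[OF assms])
  ultimately show ?thesis
    by (simp add: psd_matrix_def transpose_eqI)
qed

text \<open>Blockwise minimality sums to minimality of the stacked criterion, which yields all
  blocks of the equations at once.\<close>

lemma local_linear_normal_equations:
  assumes psd: "psd_matrix (S_mat X K h t)"
    and b: "is_local_linear_estimator X Y K h t b"
  shows "S_mat X K h t *v b = L_vec X Y K h t"
proof -
  obtain C where C: "\<And>b. (\<Sum>j\<in>UNIV. SSR X Y K h (block b j) (t j))
      = C + (b \<bullet> (S_mat X K h t *v b) - 2 * (L_vec X Y K h t \<bullet> b))"
    using sum_SSR_quadratic by blast
  have "(\<Sum>j\<in>UNIV. SSR X Y K h (block b j) (t j))
      \<le> (\<Sum>j\<in>UNIV. SSR X Y K h (block c j) (t j))" for c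
    using b by (intro sum_mono) (simp add: is_local_linear_estimator_def is_arg_min_linorder)
  then show ?thesis
    unfolding C by (intro quadratic_minimizer_iff[OF psd, THEN iffD1]) simp
qed

text \<open>The penalty adds R(I - P) to the quadratic form, so the normal equations characterize
  the minimizers.\<close>

lemma penalized_minimizerI:
  assumes psdS: "psd_matrix (S_mat X K h t)" and R: "R > 0"
    and P: "transpose (P_add t) = P_add t"
    and b: "S_mat X K h t *v b + R *\<^sub>R (b - P_add t *v b) = L_vec X Y K h t"
  shows "is_arg_min (penalized_criterion X Y K h t R) (\<lambda>_. True) b"
proof -
  note Q = psd_matrix_orthogonal_complement[OF is_orthogonal_projection_P_add P]
  define H where "H = S_mat X K h t + R *\<^sub>R (mat 1 - P_add t)"
  have Hv: "H *v x = S_mat X K h t *v x + R *\<^sub>R ((mat 1 - P_add t) *v x)" for x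
    by (simp add: H_def matrix_vector_mult_add_rdistrib scaleR_matrix_vector_assoc[symmetric])
  have psdH: "psd_matrix H"
  proof -
    have "x \<bullet> (H *v y) = (H *v x) \<bullet> y" for x y
      using symmetric_matrix_inner[of "S_mat X K h t" x y]
        symmetric_matrix_inner[of "mat 1 - P_add t" x y] psdS Q(2)
      by (simp add: Hv inner_add_left inner_add_right psd_matrix_def)
    moreover have "0 \<le> x \<bullet> (H *v x)" for x
      using psdS Q(2) R by (simp add: psd_matrix_def Hv inner_add_right)
    ultimately show ?thesis
      by (simp add: psd_matrix_def transpose_eqI)
  qed
  obtain C where C: "\<And>b. (\<Sum>j\<in>UNIV. SSR X Y K h (block b j) (t j))
      = C + (b \<bullet> (S_mat X K h t *v b) - 2 * (L_vec X Y K h t \<bullet> b))"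
    using sum_SSR_quadratic by blast
  have "penalized_criterion X Y K h t R c
      = C + (c \<bullet> (H *v c) - 2 * (L_vec X Y K h t \<bullet> c))" for c
    unfolding penalized_criterion_def C Hv
    by (simp only: inner_add_right inner_scaleR_right Q(3))
  moreover have "H *v b = L_vec X Y K h t"
    using b by (simp add: Hv matrix_vector_mult_diff_rdistrib)
  ultimately show ?thesis
    using quadratic_minimizer_iff[OF psdH, of b "L_vec X Y K h t"]
    by (simp add: is_arg_min_linorder)
qed


subsection \<open>The penalized estimator\<close>

theorem proposition2:
  fixes X :: "'n::finite \<Rightarrow> real ^ 'd::finite"
    and Y :: "'n \<Rightarrow> real"
    and h :: "'d \<Rightarrow> real"
    and K :: "real ^ 'd \<Rightarrow> real ^ 'd \<Rightarrow> real"
    and mm :: "'d \<Rightarrow> nat"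
    and s :: "'d \<Rightarrow> nat \<Rightarrow> real"
    and e :: "'m::finite \<Rightarrow> 'd \<Rightarrow> nat"
    and t :: "'m \<Rightarrow> real ^ 'd"
    and Z :: "real ^ ('m \<times> 'd option) ^ 'p::finite"
    and G :: "real ^ 'p ^ 'p"
    and \<beta>_ll :: "real ^ ('m \<times> 'd option)"
    and R :: real
  assumes "\<And>i. X i \<in> cbox 0 1"
    and "\<And>k. h k > 0"
    and "\<And>i x. x \<in> cbox 0 1 \<Longrightarrow> K (X i) x \<ge> 0"
    and "\<And>k a. a \<in> {1..mm k} \<Longrightarrow> s k a \<in> {0..1}"
    and "bij_betw e UNIV {c. \<forall>k. c k \<in> {1..mm k}}"
    and "\<And>j. t j = (\<chi> k. s k (e j k))"
    and "transpose Z ** Z = P_add t"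
    and "R > 0"
    and "is_generalized_inverse (braces_mat (A_mat X K h t R) Z) G"
    and "is_local_linear_estimator X Y K h t \<beta>_ll"
  shows "P_add t *v penalized_estimator X Y K h t R Z G =
        P_oblique (A_mat X K h t R) Z G *v \<beta>_ll \<and>
      (mat 1 - P_add t) *v penalized_estimator X Y K h t R Z G =
        (mat 1 - A_mat X K h t R) *v
          ((mat 1 - P_oblique (A_mat X K h t R) Z G) *v \<beta>_ll)"
proof -
  \<comment> \<open>The kernel weights are known to be nonnegative only at points of the unit
    cube.\<close>
  have t: "t j \<in> cbox 0 1" for j
  proof -
    have "e j k \<in> {1..mm k}" for k
      using bij_betwE[OF assms(5)] by blast
    then have "s k (e j k) \<in> {0..1}" for k
      by (rule assms(4))
    then show ?thesis
      by (simp add: assms(6) mem_box_cart)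
  qed
  define S A L B where "S = S_mat X K h t" and "A = A_mat X K h t R"
    and "L = L_vec X Y K h t" and "B = S + R *\<^sub>R mat 1"
  have A_eq: "A = R *\<^sub>R matrix_inv B"
    by (simp add: A_def B_def S_def A_mat_def)
  have psdS: "psd_matrix S"
    unfolding S_def by (rule psd_S_mat) (use assms(3) t in blast)
  note shrinkage = ridge_inverse[OF psdS \<open>R > 0\<close>, folded B_def]
    shrinkage_apply[OF psdS \<open>R > 0\<close>, folded B_def, folded A_eq]
    psd_shrinkage[OF psdS \<open>R > 0\<close>, folded B_def, folded A_eq]
  have symP: "transpose (P_add t) = P_add t"
    unfolding assms(7)[symmetric] by (simp add: matrix_transpose_mul)
  have PP: "P_add t ** P_add t = P_add t"
    by (rule psd_matrix_orthogonal_complement(1)[OF is_orthogonal_projection_P_add symP])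
  define v where "v = P_oblique A Z G *v \<beta>_ll"
  define b where "b = penalized_solution X Y K h t R Z G"
  have L: "S *v \<beta>_ll = L"
    unfolding S_def L_def
    by (rule local_linear_normal_equations[OF psdS[unfolded S_def] assms(10)])
  then have q: "matrix_inv B *v L = (mat 1 - A) *v \<beta>_ll"
    using shrinkage(2) by metis
  have b_eq: "b = (mat 1 - A) *v \<beta>_ll + A *v v"
    unfolding b_def penalized_solution_def S_def[symmetric] A_def[symmetric] L_def[symmetric]
      B_def[symmetric] q v_def P_oblique_def
    by (simp add: matrix_vector_mult_add_rdistrib matrix_vector_mul_assoc[symmetric])
  have Pb: "P_add t *v b = v"
    unfolding b_eq v_def
    by (rule oblique_solution[OF assms(7) PP shrinkage(3) assms(9)[folded A_def]])
  \<comment> \<open>Since BA = RI, multiplying \<open>b\<close> by \<open>B\<close> gives L + Rv = L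
    + RPb; subtracting RPb leaves the normal equations.\<close>
  have "A *v v = R *\<^sub>R (matrix_inv B *v v)"
    by (simp add: A_eq scaleR_matrix_vector_assoc[symmetric])
  then have "B *v b = L + R *\<^sub>R v"
    unfolding b_eq q[symmetric]
    by (simp add: matrix_vector_right_distrib shrinkage(1) matrix_vector_mult_scaleR)
  then have "S *v b + R *\<^sub>R (b - P_add t *v b) = L"
    by (simp add: B_def Pb matrix_vector_mult_add_rdistrib scaleR_matrix_vector_assoc[symmetric]
        algebra_simps)
  then have min: "is_arg_min (penalized_criterion X Y K h t R) (\<lambda>_. True) b"
    unfolding S_def L_def
    by (rule penalized_minimizerI[OF psdS[unfolded S_def] \<open>R > 0\<close> symP])
  \<comment> \<open>A unique minimizer must be \<open>b\<close>, which is a minimizer; otherwise the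
    estimator is \<open>b\<close> by definition.\<close>
  have "penalized_estimator X Y K h t R Z G = b"
  proof (cases "\<exists>!b. is_arg_min (penalized_criterion X Y K h t R) (\<lambda>_. True) b")
    case True
    then show ?thesis
      using min by (auto simp: penalized_estimator_def arg_min_def intro: some1_equality)
  next
    case False
    then show ?thesis
      by (simp add: penalized_estimator_def b_def)
  qed
  \<comment> \<open>Subtracting Pb = v from \<open>b\<close> leaves (I - A)
    \<open>\<beta>_ll\<close> + Av - v.\<close>
  moreover have "(mat 1 - P_add t) *v b = (mat 1 - A) *v (\<beta>_ll - v)"
    by (simp add: matrix_vector_mult_diff_rdistrib matrix_vector_mult_diff_distrib Pb)
      (simp add: b_eq matrix_vector_mult_diff_rdistrib)
  ultimately show ?thesis
    using Pb by (simp add: A_def[symmetric] v_def matrix_vector_mult_diff_rdistrib)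
qed

end
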